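(* Let $n\ge 2$. In the region $\{(s,t): s<0,\ t>0\}$, all Bridgeland walls for the Chern character $(1,0,-n)$ are non-intersecting, nested semicircles with center on the real axis. More precisely, the potential wall in this region attached to $(1,0,-n)$ and the Chern character $(r,c,d)$ of a destabilizing object is a semicircle with center $(x,0)$ and radius $\sqrt{x^2-2n}$, where $x=\frac{d+rn}{c}$, and any two distinct such semicircles are disjoint and nested.
   Context: Write Chern characters on $\mathbb{P}^2$ as $(r,c,d)$, meaning $(r,cL,dL^2)$ with $L$ the line class. For $s\in\mathbb{R}$, $t>0$ the slope function is $$\mu_{s,t}(r,c,d)=\frac{-\frac{t^2}{2}r+(d-sc+\frac{s^2}{2}r)}{t(c-sr)}.$$ The potential wall attached to two non-proportional Chern characters is the set of $(s,t)$, $t>0$, where $\mu_{s,t}(r,c,d)=\mu_{s,t}(r',c',d')$, i.e. $$(s^2+t^2)(rc'-r'c)-2s(rd'-r'd)+2(cd'-c'd)=0.$$ For $s\in\mathbb{R}$, $\mathcal{Q}_s$ is the category of coherent sheaves on $\mathbb{P}^2$ that are torsion or all of whose torsion-free Mumford Harder–Narasimhan factors have slope $c/r>s$, $\mathcal{F}_s$ the category of torsion-free sheaves with all Mumford Harder–Narasimhan factors of slope $\le s$, and $\mathcal{A}_s\subset D^b(\mathrm{coh}(\mathbb{P}^2))$ the heart of objects $E$ with $H^{-1}(E)\in\mathcal{F}_s$, $H^0(E)\in\mathcal{Q}_s$, $H^i(E)=0$ otherwise; (semi-)stability of objects of $\mathcal{A}_s$ is with respect to $\mu_{s,t}$. A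 Bridgeland wall for $(1,0,-n)$ is a potential wall attached to $(1,0,-n)$ and the Chern character of an object $A$ at some point of which $A\subset E$ in $\mathcal{A}_s$ is an inclusion of semi-stable objects of equal slope with $\mathrm{ch}(E)=(1,0,-n)$; $A$ is then called a destabilizing object. *)

theory Defs
  imports "HOL-Analysis.Analysis" "HOL-Algebra.Module"
begin

section \<open>The complex projective plane as a ringed space\<close>

definition cline :: "complex^3 \<Rightarrow> (complex^3) set" where
  "cline v = range (\<lambda>a. a *s v)"

typedef P2 = "{L. \<exists>v. v \<noteq> 0 \<and> L = cline v}"
  morphisms line_of Abs_P2
proof -
  have "axis 1 1 \<noteq> (0 :: complex^3)"
    by (simp add: axis_eq_0_iff)
  then show ?thesis by blast
qed

definition point :: "complex^3 \<Rightarrow> P2" where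
  "point v = Abs_P2 (cline v)"

definition punctured_cone :: "P2 set \<Rightarrow> (complex^3) set" where
  "punctured_cone U = (\<Union>p\<in>U. line_of p) - {0}"

text \<open>Homogeneous polynomials of degree \<open>m\<close> in three variables, as polynomial functions.\<close>

definition homogeneous_poly :: "nat \<Rightarrow> (complex^3 \<Rightarrow> complex) set" where
  "homogeneous_poly m = {P. \<exists>c :: nat \<Rightarrow> nat \<Rightarrow> complex. \<forall>v.
     P v = (\<Sum>i\<le>m. \<Sum>j\<le>m - i. c i j * (v$1)^i * (v$2)^j * (v$3)^(m - i - j))}"

definition zariski_open :: "P2 set \<Rightarrow> bool" where
  "zariski_open U \<longleftrightarrow> (\<exists>S \<subseteq> (\<Union>m. homogeneous_poly m).
     U = {p. \<exists>P\<in>S. \<exists>v\<in>line_of p. P v \<noteq> 0})"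

text \<open>Functions on an open set are represented by functions that vanish outside of it, so that
  equality of sections is equality of functions.\<close>

definition regular :: "P2 set \<Rightarrow> (P2 \<Rightarrow> complex) set" where
  "regular U = {f. (\<forall>p. p \<notin> U \<longrightarrow> f p = 0) \<and>
     (\<forall>p\<in>U. \<exists>V m. \<exists>P\<in>homogeneous_poly m. \<exists>Q\<in>homogeneous_poly m.
        zariski_open V \<and> p \<in> V \<and> V \<subseteq> U \<and>
        (\<forall>v\<in>punctured_cone V. Q v \<noteq> 0 \<and> f (point v) = P v / Q v))}"

definition structure_ring :: "P2 set \<Rightarrow> (P2 \<Rightarrow> complex) ring" where
  "structure_ring U =
     \<lparr>carrier = regular U, mult = (\<lambda>f g p. f p * g p), one = (\<lambda>p. if p \<in> U then 1 else 0),
      zero = (\<lambda>p. 0), add = (\<lambda>f g p. f p + g p)\<rparr>"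

definition regular_restrict :: "P2 set \<Rightarrow> (P2 \<Rightarrow> complex) \<Rightarrow> P2 \<Rightarrow> complex" where
  "regular_restrict V f = (\<lambda>p. if p \<in> V then f p else 0)"


section \<open>Sheaves of modules\<close>

text \<open>\<open>res F U V\<close> is the restriction map from \<open>U\<close> to \<open>V\<close>. The multiplication and the unit that
  the HOL-Algebra record type provides for a module carry no meaning.\<close>

record 'a osheaf =
  sections :: "P2 set \<Rightarrow> (P2 \<Rightarrow> complex, 'a) module"
  res :: "P2 set \<Rightarrow> P2 set \<Rightarrow> 'a \<Rightarrow> 'a"

definition linear_maps ::
    "('r, 'x) ring_scheme \<Rightarrow> ('r, 'a) module \<Rightarrow> ('r, 'b) module \<Rightarrow> ('a \<Rightarrow> 'b) set" where
  "linear_maps R M N = {h \<in> carrier M \<rightarrow> carrier N.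
     (\<forall>x\<in>carrier M. \<forall>y\<in>carrier M. h (x \<oplus>\<^bsub>M\<^esub> y) = h x \<oplus>\<^bsub>N\<^esub> h y) \<and>
     (\<forall>a\<in>carrier R. \<forall>x\<in>carrier M. h (a \<odot>\<^bsub>M\<^esub> x) = a \<odot>\<^bsub>N\<^esub> h x)}"

definition sheaf :: "'a osheaf \<Rightarrow> bool" where
  "sheaf F \<longleftrightarrow>
     (\<forall>U. zariski_open U \<longrightarrow> Module.module (structure_ring U) (sections F U)) \<and>
     (\<forall>U V. zariski_open U \<and> zariski_open V \<and> V \<subseteq> U \<longrightarrow>
        res F U V \<in> carrier (sections F U) \<rightarrow> carrier (sections F V) \<and>
        (\<forall>x\<in>carrier (sections F U). \<forall>y\<in>carrier (sections F U).
           res F U V (x \<oplus>\<^bsub>sections F U\<^esub> y) = res F U V x \<oplus>\<^bsub>sections F V\<^esub> res F U V y) \<and>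
        (\<forall>a\<in>regular U. \<forall>x\<in>carrier (sections F U).
           res F U V (a \<odot>\<^bsub>sections F U\<^esub> x)
             = regular_restrict V a \<odot>\<^bsub>sections F V\<^esub> res F U V x)) \<and>
     (\<forall>U. zariski_open U \<longrightarrow> (\<forall>x\<in>carrier (sections F U). res F U U x = x)) \<and>
     (\<forall>U V W. zariski_open U \<and> zariski_open V \<and> zariski_open W \<and> W \<subseteq> V \<and> V \<subseteq> U \<longrightarrow>
        (\<forall>x\<in>carrier (sections F U). res F V W (res F U V x) = res F U W x)) \<and>
     (\<forall>\<U> s. (\<forall>V\<in>\<U>. zariski_open V \<and> s V \<in> carrier (sections F V)) \<and>
        (\<forall>V\<in>\<U>. \<forall>W\<in>\<U>. res F V (V \<inter> W) (s V) = res F W (V \<inter> W) (s W)) \<longrightarrow>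
        (\<exists>!x. x \<in> carrier (sections F (\<Union>\<U>)) \<and> (\<forall>V\<in>\<U>. res F (\<Union>\<U>) V x = s V)))"

type_synonym ('a, 'b) sheaf_map = "P2 set \<Rightarrow> 'a \<Rightarrow> 'b"

definition sheaf_hom :: "'a osheaf \<Rightarrow> 'b osheaf \<Rightarrow> ('a, 'b) sheaf_map \<Rightarrow> bool" where
  "sheaf_hom F G \<phi> \<longleftrightarrow>
     (\<forall>U. zariski_open U \<longrightarrow>
        \<phi> U \<in> linear_maps (structure_ring U) (sections F U) (sections G U)) \<and>
     (\<forall>U V. zariski_open U \<and> zariski_open V \<and> V \<subseteq> U \<longrightarrow>
        (\<forall>x\<in>carrier (sections F U). \<phi> V (res F U V x) = res G U V (\<phi> U x)))"

definition sheaf_iso :: "'a osheaf \<Rightarrow> 'b osheaf \<Rightarrow> ('a, 'b) sheaf_map \<Rightarrow> bool" where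
  "sheaf_iso F G \<phi> \<longleftrightarrow> sheaf_hom F G \<phi> \<and>
     (\<forall>U. zariski_open U \<longrightarrow>
        bij_betw (\<phi> U) (carrier (sections F U)) (carrier (sections G U)))"

definition zero_sheaf :: "'a osheaf \<Rightarrow> bool" where
  "zero_sheaf F \<longleftrightarrow> (\<forall>U. zariski_open U \<longrightarrow> carrier (sections F U) = {\<zero>\<^bsub>sections F U\<^esub>})"

text \<open>Sections of the image sheaf, which is the sheafification of the sectionwise image.\<close>

definition image_sections ::
    "'a osheaf \<Rightarrow> 'b osheaf \<Rightarrow> ('a, 'b) sheaf_map \<Rightarrow> P2 set \<Rightarrow> 'b set" where
  "image_sections F G \<phi> U = {y \<in> carrier (sections G U). \<forall>p\<in>U. \<exists>V. zariski_open V \<and> p \<in> V \<and> V \<subseteq> U \<and>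
     res G U V y \<in> \<phi> V ` carrier (sections F V)}"

definition kernel_sections ::
    "'a osheaf \<Rightarrow> 'b osheaf \<Rightarrow> ('a, 'b) sheaf_map \<Rightarrow> P2 set \<Rightarrow> 'a set" where
  "kernel_sections F G \<phi> U = {x \<in> carrier (sections F U). \<phi> U x = \<zero>\<^bsub>sections G U\<^esub>}"

definition kernel_sheaf :: "'a osheaf \<Rightarrow> 'b osheaf \<Rightarrow> ('a, 'b) sheaf_map \<Rightarrow> 'a osheaf" where
  "kernel_sheaf F G \<phi> =
     F\<lparr>sections := \<lambda>U. (sections F U)\<lparr>carrier := kernel_sections F G \<phi> U\<rparr>\<rparr>"

definition sheaf_mono :: "'a osheaf \<Rightarrow> 'b osheaf \<Rightarrow> ('a, 'b) sheaf_map \<Rightarrow> bool" where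
  "sheaf_mono F G \<phi> \<longleftrightarrow> sheaf_hom F G \<phi> \<and>
     (\<forall>U. zariski_open U \<longrightarrow> kernel_sections F G \<phi> U = {\<zero>\<^bsub>sections F U\<^esub>})"

definition sheaf_epi :: "'a osheaf \<Rightarrow> 'b osheaf \<Rightarrow> ('a, 'b) sheaf_map \<Rightarrow> bool" where
  "sheaf_epi F G \<phi> \<longleftrightarrow> sheaf_hom F G \<phi> \<and>
     (\<forall>U. zariski_open U \<longrightarrow> image_sections F G \<phi> U = carrier (sections G U))"


section \<open>Coherent sheaves\<close>

definition combination ::
    "'a osheaf \<Rightarrow> P2 set \<Rightarrow> nat \<Rightarrow> (nat \<Rightarrow> P2 \<Rightarrow> complex) \<Rightarrow> (nat \<Rightarrow> 'a) \<Rightarrow> 'a" where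
  "combination F U k a x = finsum (sections F U) (\<lambda>i. a i \<odot>\<^bsub>sections F U\<^esub> x i) {..<k}"

definition finite_type :: "'a osheaf \<Rightarrow> bool" where
  "finite_type F \<longleftrightarrow> (\<forall>p. \<exists>U k x. zariski_open U \<and> p \<in> U \<and> (\<forall>i<k. x i \<in> carrier (sections F U)) \<and>
     (\<forall>V. zariski_open V \<and> V \<subseteq> U \<longrightarrow> (\<forall>y\<in>carrier (sections F V). \<forall>q\<in>V.
        \<exists>W a. zariski_open W \<and> q \<in> W \<and> W \<subseteq> V \<and> (\<forall>i<k. a i \<in> regular W) \<and>
          res F V W y = combination F W k a (\<lambda>i. res F U W (x i)))))"

text \<open>The sections over \<open>V\<close> of the kernel of the morphism from the free sheaf of rank \<open>k\<close> on \<open>U\<close>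
  to \<open>F\<close> restricted to \<open>U\<close> given by \<open>k\<close> sections over \<open>U\<close>.\<close>

definition relations ::
    "'a osheaf \<Rightarrow> P2 set \<Rightarrow> nat \<Rightarrow> (nat \<Rightarrow> 'a) \<Rightarrow> P2 set \<Rightarrow> (nat \<Rightarrow> P2 \<Rightarrow> complex) set" where
  "relations F U k x V = {a. (\<forall>i<k. a i \<in> regular V) \<and>
     combination F V k a (\<lambda>i. res F U V (x i)) = \<zero>\<^bsub>sections F V\<^esub>}"

text \<open>Serre's definition: finite type, and every sheaf of relations between finitely many sections
  is of finite type.\<close>

definition coherent :: "'a osheaf \<Rightarrow> bool" where
  "coherent F \<longleftrightarrow> sheaf F \<and> finite_type F \<and>
     (\<forall>U k x. zariski_open U \<and> (\<forall>i<k. x i \<in> carrier (sections F U)) \<longrightarrow>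
       (\<forall>p\<in>U. \<exists>V (m :: nat) b. zariski_open V \<and> p \<in> V \<and> V \<subseteq> U \<and> (\<forall>j<m. b j \<in> relations F U k x V) \<and>
         (\<forall>W. zariski_open W \<and> W \<subseteq> V \<longrightarrow> (\<forall>a\<in>relations F U k x W. \<forall>q\<in>W.
            \<exists>W' e. zariski_open W' \<and> q \<in> W' \<and> W' \<subseteq> W \<and> (\<forall>j<m. e j \<in> regular W') \<and>
              (\<forall>i<k. \<forall>q'\<in>W'. a i q' = (\<Sum>j<m. e j q' * b j i q'))))))"

text \<open>HOL has no type of all coherent sheaves, so the sections of the sheaves that are quantified
  over below live in one fixed type. Modules of sections of a coherent sheaf have at most the
  cardinality of the continuum, hence every coherent sheaf is isomorphic to one of this type; the
  type is chosen such that it also contains the twisting sheaves themselves.\<close>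

type_synonym sect = "complex^3 \<Rightarrow> complex"
type_synonym osh = "sect osheaf"
type_synonym osh_map = "(sect, sect) sheaf_map"

definition short_exact :: "osh \<Rightarrow> osh \<Rightarrow> osh \<Rightarrow> bool" where
  "short_exact A B C \<longleftrightarrow> coherent A \<and> coherent B \<and> coherent C \<and>
     (\<exists>\<phi> \<psi>. sheaf_mono A B \<phi> \<and> sheaf_epi B C \<psi> \<and>
       (\<forall>U. zariski_open U \<longrightarrow> kernel_sections B C \<psi> U = image_sections A B \<phi> U))"

text \<open>The invertible sheaf \<open>\<O>(a)\<close>: functions on the cone that are locally quotients of homogeneous
  polynomials whose degrees differ by \<open>a\<close>.\<close>

definition twist_sections :: "int \<Rightarrow> P2 set \<Rightarrow> sect set" where
  "twist_sections a U = {f. (\<forall>v. v \<notin> punctured_cone U \<longrightarrow> f v = 0) \<and>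
     (\<forall>p\<in>U. \<exists>V k m. \<exists>P\<in>homogeneous_poly k. \<exists>Q\<in>homogeneous_poly m.
        int k - int m = a \<and> zariski_open V \<and> p \<in> V \<and> V \<subseteq> U \<and>
        (\<forall>v\<in>punctured_cone V. Q v \<noteq> 0 \<and> f v = P v / Q v))}"

definition twist :: "int \<Rightarrow> osh" where
  "twist a =
     \<lparr>sections = \<lambda>U. \<lparr>carrier = twist_sections a U, mult = undefined, one = undefined,
        zero = (\<lambda>v. 0), add = (\<lambda>f g v. f v + g v), smult = (\<lambda>h f v. h (point v) * f v)\<rparr>,
      res = \<lambda>U V f v. if v \<in> punctured_cone V then f v else 0\<rparr>"


section \<open>Chern characters of coherent sheaves\<close>

text \<open>\<open>(r, c, d)\<close> stands for \<open>(r, c L, d L\<^sup>2)\<close>. The Chern character is the homomorphism on the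
  Grothendieck group of coherent sheaves, which the classes of the \<open>\<O>(a)\<close> generate, that sends
  \<open>\<O>(a)\<close> to \<open>exp (a L)\<close>. The inductive predicate computes it along short exact sequences.\<close>

type_synonym chern = "real \<times> real \<times> real"

inductive has_ch :: "osh \<Rightarrow> chern \<Rightarrow> bool" where
  has_ch_twist: "has_ch (twist a) (1, of_int a, (of_int a)\<^sup>2 / 2)"
| has_ch_middle: "short_exact A B C \<Longrightarrow> has_ch A u \<Longrightarrow> has_ch C w \<Longrightarrow> has_ch B (u + w)"
| has_ch_left: "short_exact A B C \<Longrightarrow> has_ch B v \<Longrightarrow> has_ch C w \<Longrightarrow> has_ch A (v - w)"
| has_ch_right: "short_exact A B C \<Longrightarrow> has_ch A u \<Longrightarrow> has_ch B v \<Longrightarrow> has_ch C (v - u)"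

definition ch_sheaf :: "osh \<Rightarrow> chern" where
  "ch_sheaf F = (THE v. has_ch F v)"


section \<open>Mumford stability\<close>

definition torsion_sheaf :: "osh \<Rightarrow> bool" where
  "torsion_sheaf F \<longleftrightarrow> coherent F \<and>
     (\<forall>U. zariski_open U \<longrightarrow> (\<forall>x\<in>carrier (sections F U). \<forall>p\<in>U.
        \<exists>V. \<exists>f\<in>regular V. zariski_open V \<and> p \<in> V \<and> V \<subseteq> U \<and> f \<noteq> \<zero>\<^bsub>structure_ring V\<^esub> \<and>
          f \<odot>\<^bsub>sections F V\<^esub> res F U V x = \<zero>\<^bsub>sections F V\<^esub>))"

definition torsion_free_sheaf :: "osh \<Rightarrow> bool" where
  "torsion_free_sheaf F \<longleftrightarrow> coherent F \<and>
     (\<forall>U. zariski_open U \<longrightarrow> (\<forall>f\<in>regular U. \<forall>x\<in>carrier (sections F U).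
        f \<odot>\<^bsub>sections F U\<^esub> x = \<zero>\<^bsub>sections F U\<^esub> \<longrightarrow>
        f = \<zero>\<^bsub>structure_ring U\<^esub> \<or> x = \<zero>\<^bsub>sections F U\<^esub>))"

definition rank_sheaf :: "osh \<Rightarrow> real" where
  "rank_sheaf F = fst (ch_sheaf F)"

definition mumford_slope :: "osh \<Rightarrow> real" where
  "mumford_slope F = fst (snd (ch_sheaf F)) / fst (ch_sheaf F)"

definition mumford_semistable :: "osh \<Rightarrow> bool" where
  "mumford_semistable F \<longleftrightarrow> torsion_free_sheaf F \<and> \<not> zero_sheaf F \<and>
     (\<forall>G \<phi>. coherent G \<and> sheaf_mono G F \<phi> \<and> 0 < rank_sheaf G \<and> rank_sheaf G < rank_sheaf F \<longrightarrow>
        mumford_slope G \<le> mumford_slope F)"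

text \<open>\<open>mumford_HN F Gs\<close>: \<open>F\<close> has a filtration whose first step is the torsion subsheaf and whose
  further factors are \<open>Gs\<close>, torsion-free and semistable with strictly decreasing slopes.\<close>

inductive mumford_HN :: "osh \<Rightarrow> osh list \<Rightarrow> bool" where
  torsion: "torsion_sheaf F \<Longrightarrow> mumford_HN F []"
| extend: "mumford_HN F' Gs \<Longrightarrow> short_exact F' F G \<Longrightarrow> mumford_semistable G \<Longrightarrow>
     Gs \<noteq> [] \<longrightarrow> mumford_slope (last Gs) > mumford_slope G \<Longrightarrow> mumford_HN F (Gs @ [G])"

definition tilt_Q :: "real \<Rightarrow> osh set" where
  "tilt_Q s = {F. coherent F \<and> (torsion_sheaf F \<or>
     (\<exists>Gs. mumford_HN F Gs \<and> (\<forall>G\<in>set Gs. mumford_slope G > s)))}"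

definition tilt_F :: "real \<Rightarrow> osh set" where
  "tilt_F s = {F. torsion_free_sheaf F \<and>
     (\<exists>Gs. mumford_HN F Gs \<and> (\<forall>G\<in>set Gs. mumford_slope G \<le> s))}"


section \<open>The bounded derived category of coherent sheaves\<close>

record cpx =
  obj :: "int \<Rightarrow> osh"
  diff :: "int \<Rightarrow> osh_map"

type_synonym chain = "int \<Rightarrow> osh_map"

definition bounded_complex :: "cpx \<Rightarrow> bool" where
  "bounded_complex E \<longleftrightarrow>
     (\<forall>i. coherent (obj E i) \<and> sheaf_hom (obj E i) (obj E (i + 1)) (diff E i)) \<and>
     (\<forall>i U. zariski_open U \<longrightarrow> (\<forall>x\<in>carrier (sections (obj E i) U).
        diff E (i + 1) U (diff E i U x) = \<zero>\<^bsub>sections (obj E (i + 2)) U\<^esub>)) \<and>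
     finite {i. \<not> zero_sheaf (obj E i)}"

definition chain_map :: "cpx \<Rightarrow> cpx \<Rightarrow> chain \<Rightarrow> bool" where
  "chain_map E G f \<longleftrightarrow> (\<forall>i. sheaf_hom (obj E i) (obj G i) (f i) \<and>
     (\<forall>U. zariski_open U \<longrightarrow> (\<forall>x\<in>carrier (sections (obj E i) U).
        f (i + 1) U (diff E i U x) = diff G i U (f i U x))))"

definition chain_comp :: "chain \<Rightarrow> chain \<Rightarrow> chain" where
  "chain_comp g f = (\<lambda>i U x. g i U (f i U x))"

definition homotopic :: "cpx \<Rightarrow> cpx \<Rightarrow> chain \<Rightarrow> chain \<Rightarrow> bool" where
  "homotopic E G f g \<longleftrightarrow> (\<exists>h :: chain. \<forall>i. sheaf_hom (obj E i) (obj G (i - 1)) (h i) \<and>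
     (\<forall>U. zariski_open U \<longrightarrow> (\<forall>x\<in>carrier (sections (obj E i) U).
        f i U x = g i U x \<oplus>\<^bsub>sections (obj G i) U\<^esub>
          (diff G (i - 1) U (h i U x) \<oplus>\<^bsub>sections (obj G i) U\<^esub> h (i + 1) U (diff E i U x)))))"

definition cocycles :: "cpx \<Rightarrow> int \<Rightarrow> osh" where
  "cocycles E i = kernel_sheaf (obj E i) (obj E (i + 1)) (diff E i)"

text \<open>\<open>is_cohomology E i H \<pi>\<close>: the sheaf \<open>H\<close> together with the projection \<open>\<pi>\<close> from the cocycles is
  the \<open>i\<close>-th cohomology sheaf of \<open>E\<close>, that is, the quotient of the cocycles by the image of the
  preceding differential.\<close>

definition is_cohomology :: "cpx \<Rightarrow> int \<Rightarrow> osh \<Rightarrow> osh_map \<Rightarrow> bool" where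
  "is_cohomology E i H \<pi> \<longleftrightarrow> coherent H \<and> sheaf_epi (cocycles E i) H \<pi> \<and>
     (\<forall>U. zariski_open U \<longrightarrow> kernel_sections (cocycles E i) H \<pi> U
        = image_sections (obj E (i - 1)) (obj E i) (diff E (i - 1)) U)"

definition quasi_iso :: "cpx \<Rightarrow> cpx \<Rightarrow> chain \<Rightarrow> bool" where
  "quasi_iso E G f \<longleftrightarrow> chain_map E G f \<and>
     (\<forall>i. \<exists>H \<pi> H' \<pi>' h. is_cohomology E i H \<pi> \<and> is_cohomology G i H' \<pi>' \<and> sheaf_iso H H' h \<and>
        (\<forall>U. zariski_open U \<longrightarrow> (\<forall>x\<in>carrier (sections (cocycles E i) U).
           h U (\<pi> U x) = \<pi>' U (f i U x))))"

text \<open>Objects of the derived category are the bounded complexes. A morphism from \<open>X\<close> to \<open>Y\<close> is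
  represented by a roof \<open>(W, q, f)\<close>, where \<open>q\<close> is a quasi-isomorphism from \<open>W\<close> to \<open>X\<close> and \<open>f\<close> is a
  chain map from \<open>W\<close> to \<open>Y\<close>.\<close>

type_synonym roof = "cpx \<times> chain \<times> chain"

fun is_roof :: "cpx \<Rightarrow> cpx \<Rightarrow> roof \<Rightarrow> bool" where
  "is_roof X Y (W, q, f) \<longleftrightarrow> bounded_complex W \<and> quasi_iso W X q \<and> chain_map W Y f"

fun roof_eq :: "cpx \<Rightarrow> cpx \<Rightarrow> roof \<Rightarrow> roof \<Rightarrow> bool" where
  "roof_eq X Y (W, q, f) (W', q', f') \<longleftrightarrow>
     (\<exists>V a a'. bounded_complex V \<and> quasi_iso V W a \<and> quasi_iso V W' a' \<and>
        homotopic V X (chain_comp q a) (chain_comp q' a') \<and>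
        homotopic V Y (chain_comp f a) (chain_comp f' a'))"

text \<open>\<open>roof_comp Y \<beta> \<alpha> \<gamma>\<close>: the roof \<open>\<gamma>\<close> represents \<open>\<beta> \<circ> \<alpha>\<close>, where \<open>Y\<close> is the target of \<open>\<alpha>\<close> and the
  source of \<open>\<beta>\<close>.\<close>

fun roof_comp :: "cpx \<Rightarrow> roof \<Rightarrow> roof \<Rightarrow> roof \<Rightarrow> bool" where
  "roof_comp Y (W', q', f') (W, q, f) \<gamma> \<longleftrightarrow>
     (\<exists>V a b. bounded_complex V \<and> quasi_iso V W a \<and> chain_map V W' b \<and>
        homotopic V Y (chain_comp f a) (chain_comp q' b) \<and>
        \<gamma> = (V, chain_comp q a, chain_comp f' b))"

definition ch :: "cpx \<Rightarrow> chern" where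
  "ch E = (\<Sum>i | \<not> zero_sheaf (obj E i).
     if even i then ch_sheaf (obj E i) else - ch_sheaf (obj E i))"


section \<open>Tilted hearts and Bridgeland stability\<close>

definition heart :: "real \<Rightarrow> cpx set" where
  "heart s = {E. bounded_complex E \<and>
     (\<exists>H \<pi>. is_cohomology E (-1) H \<pi> \<and> H \<in> tilt_F s) \<and>
     (\<exists>H \<pi>. is_cohomology E 0 H \<pi> \<and> H \<in> tilt_Q s) \<and>
     (\<forall>i. i \<noteq> -1 \<and> i \<noteq> 0 \<longrightarrow> (\<exists>H \<pi>. is_cohomology E i H \<pi> \<and> zero_sheaf H))}"

definition zero_object :: "cpx \<Rightarrow> bool" where
  "zero_object E \<longleftrightarrow> (\<forall>i. \<exists>H \<pi>. is_cohomology E i H \<pi> \<and> zero_sheaf H)"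

definition heart_mono :: "real \<Rightarrow> cpx \<Rightarrow> cpx \<Rightarrow> roof \<Rightarrow> bool" where
  "heart_mono s A E \<phi> \<longleftrightarrow> is_roof A E \<phi> \<and>
     (\<forall>T\<in>heart s. \<forall>\<alpha> \<beta>. is_roof T A \<alpha> \<and> is_roof T A \<beta> \<and>
        (\<exists>\<gamma> \<delta>. roof_comp A \<phi> \<alpha> \<gamma> \<and> roof_comp A \<phi> \<beta> \<delta> \<and> roof_eq T E \<gamma> \<delta>) \<longrightarrow> roof_eq T A \<alpha> \<beta>)"

definition subobject :: "real \<Rightarrow> cpx \<Rightarrow> cpx \<Rightarrow> bool" where
  "subobject s A E \<longleftrightarrow> A \<in> heart s \<and> E \<in> heart s \<and> (\<exists>\<phi>. heart_mono s A E \<phi>)"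

text \<open>A nonzero object of the heart whose slope has denominator \<open>0\<close> has slope \<open>\<infinity>\<close>.\<close>

fun bridgeland_slope :: "real \<Rightarrow> real \<Rightarrow> chern \<Rightarrow> ereal" where
  "bridgeland_slope s t (r, c, d) = (if t * (c - s * r) = 0 then \<infinity>
     else ereal ((- (t\<^sup>2 / 2) * r + (d - s * c + (s\<^sup>2 / 2) * r)) / (t * (c - s * r))))"

definition semistable :: "real \<Rightarrow> real \<Rightarrow> cpx \<Rightarrow> bool" where
  "semistable s t E \<longleftrightarrow> E \<in> heart s \<and> \<not> zero_object E \<and>
     (\<forall>B. subobject s B E \<and> \<not> zero_object B \<longrightarrow>
        bridgeland_slope s t (ch B) \<le> bridgeland_slope s t (ch E))"


section \<open>Walls\<close>

definition proportional :: "chern \<Rightarrow> chern \<Rightarrow> bool" where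
  "proportional v w \<longleftrightarrow> (\<exists>a b :: real. (a, b) \<noteq> (0, 0) \<and> a *\<^sub>R v = b *\<^sub>R w)"

fun potential_wall :: "chern \<Rightarrow> chern \<Rightarrow> (real \<times> real) set" where
  "potential_wall (r, c, d) (r', c', d') = {(s, t). t > 0 \<and>
     (s\<^sup>2 + t\<^sup>2) * (r * c' - r' * c) - 2 * s * (r * d' - r' * d) + 2 * (c * d' - c' * d) = 0}"

text \<open>Where both slopes are finite, the equation of the potential wall is equality of slopes.\<close>

lemma potential_wall_iff_slope_eq:
  assumes "t > 0" "c - s * r \<noteq> 0" "c' - s * r' \<noteq> 0"
  shows "(s, t) \<in> potential_wall (r, c, d) (r', c', d') \<longleftrightarrow>
    bridgeland_slope s t (r, c, d) = bridgeland_slope s t (r', c', d')"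
proof -
  define N D N' D' where "N = - (t\<^sup>2 / 2) * r + (d - s * c + (s\<^sup>2 / 2) * r)"
    and "D = c - s * r" and "N' = - (t\<^sup>2 / 2) * r' + (d' - s * c' + (s\<^sup>2 / 2) * r')"
    and "D' = c' - s * r'"
  have "N / (t * D) = N' / (t * D') \<longleftrightarrow> t * (N * D') = t * (N' * D)"
    using assms by (simp add: D_def D'_def frac_eq_eq mult.left_commute)
  also have "\<dots> \<longleftrightarrow> N * D' - N' * D = 0"
    using assms by simp
  also have "N * D' - N' * D = - ((s\<^sup>2 + t\<^sup>2) * (r * c' - r' * c) - 2 * s * (r * d' - r' * d)
      + 2 * (c * d' - c' * d)) / 2"
    by (simp add: N_def D_def N'_def D'_def field_simps power2_eq_square)
  finally have "N / (t * D) = N' / (t * D') \<longleftrightarrow> (s\<^sup>2 + t\<^sup>2) * (r * c' - r' * c)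
      - 2 * s * (r * d' - r' * d) + 2 * (c * d' - c' * d) = 0"
    by (metis divide_eq_0_iff neg_equal_0_iff_equal zero_neq_numeral)
  then show ?thesis
    using assms unfolding N_def D_def N'_def D'_def by simp
qed

definition destabilizing_object :: "chern \<Rightarrow> real \<Rightarrow> real \<Rightarrow> cpx \<Rightarrow> bool" where
  "destabilizing_object v s t A \<longleftrightarrow>
     \<not> proportional v (ch A) \<and> (s, t) \<in> potential_wall v (ch A) \<and>
     (\<exists>E. ch E = v \<and> subobject s A E \<and> semistable s t A \<and> semistable s t E \<and>
        bridgeland_slope s t (ch A) = bridgeland_slope s t (ch E))"

definition bridgeland_walls :: "chern \<Rightarrow> (real \<times> real) set set" where
  "bridgeland_walls v =
     {W. \<exists>s t A. destabilizing_object v s t A \<and> W = potential_wall v (ch A)}"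

definition left_region :: "(real \<times> real) set" where
  "left_region = {(s, t). s < 0 \<and> t > 0}"

definition semicircle :: "real \<Rightarrow> real \<Rightarrow> (real \<times> real) set" where
  "semicircle x \<rho> = sphere (x, 0) \<rho> \<inter> {(s, t). t > 0}"

text \<open>Two semicircles are nested if the closed disc of one lies in the open disc of the other.\<close>

definition nested_semicircles :: "(real \<times> real) set \<Rightarrow> (real \<times> real) set \<Rightarrow> bool" where
  "nested_semicircles C C' \<longleftrightarrow> (\<exists>x \<rho> x' \<rho>'. \<rho> > 0 \<and> \<rho>' > 0 \<and> C = semicircle x \<rho> \<and> C' = semicircle x' \<rho>' \<and>
     (cball (x, 0 :: real) \<rho> \<subseteq> ball (x', 0) \<rho>' \<or> cball (x', 0 :: real) \<rho>' \<subseteq> ball (x, 0) \<rho>))"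

end

theory Submission
  imports Defs
begin

text \<open>By its definition a wall is a potential wall attached to \<open>(1, 0, - n)\<close> and to a character
  \<open>(r, c, d)\<close> that is not proportional to it, and the equation of this potential wall already
  forces the shape. Where \<open>c \<noteq> 0\<close>, dividing by \<open>c\<close> turns the equation into
  \<open>s\<^sup>2 + t\<^sup>2 + 2 n = 2 s x\<close> with \<open>x = (d + r n) / c\<close>, a circle of centre \<open>(x, 0)\<close> and squared
  radius \<open>x\<^sup>2 - 2 n\<close>. The left-hand side is positive, so \<open>s\<close> and \<open>x\<close> have the same sign: a wall with
  one point at negative \<open>s\<close> has \<open>x < 0\<close> and lies at negative \<open>s\<close> entirely, so the whole semicircle
  is in the region. Where \<open>c = 0\<close>, the equation reads \<open>s (d + r n) = 0\<close>, and non-proportionality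
  makes it the line \<open>s = 0\<close>, outside of the region (\<open>potential_wall_left_semicircle\<close>).

  The semicircles thus belong to a one-parameter family, indexed by \<open>x < - sqrt (2 n)\<close>. It is a part
  of the pencil of circles with respect to which the origin has power \<open>2 n\<close>. The radical axis of the
  pencil is \<open>s = 0\<close>: two of its circles could only meet there, but no point with \<open>s = 0\<close> satisfies
  the equation, as \<open>2 n > 0\<close>. The closed discs shrink as \<open>x\<close> increases
  (\<open>disc_subset\<close>).\<close>

text \<open>The equation \<open>s\<^sup>2 + t\<^sup>2 + m = 2 s x\<close> says that the origin has power \<open>m\<close> with respect to the
  circle.\<close>

lemma mem_semicircle_iff:
  assumes "x\<^sup>2 - m > 0"
  shows "(s, t) \<in> semicircle x (sqrt (x\<^sup>2 - m)) \<longleftrightarrow> t > 0 \<and> s\<^sup>2 + t\<^sup>2 + m = 2 * s * x"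
proof -
  have "dist (x, 0 :: real) (s, t) = sqrt ((x - s)\<^sup>2 + t\<^sup>2)"
    by (simp add: dist_Pair_Pair dist_real_def)
  moreover have "(x - s)\<^sup>2 + t\<^sup>2 = x\<^sup>2 - m \<longleftrightarrow> s\<^sup>2 + t\<^sup>2 + m = 2 * s * x"
    by (auto simp: power2_eq_square algebra_simps)
  ultimately show ?thesis
    by (auto simp: semicircle_def)
qed

lemma potential_wall_left_semicircle:
  fixes m r c d :: real
  defines "x \<equiv> (d + r * m) / c"
  assumes "m > 0" and "\<not> proportional (1, 0, - m) (r, c, d)"
    and "potential_wall (1, 0, - m) (r, c, d) \<inter> left_region \<noteq> {}"
  shows "c \<noteq> 0" "x < 0" "x\<^sup>2 - 2 * m > 0"
    "potential_wall (1, 0, - m) (r, c, d) \<inter> left_region = semicircle x (sqrt (x\<^sup>2 - 2 * m))"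
proof -
  obtain s t where st: "s < 0" "t > 0" "(s\<^sup>2 + t\<^sup>2) * c - 2 * s * (d + r * m) + 2 * (c * m) = 0"
    using assms(4) by (auto simp: left_region_def)
  show c: "c \<noteq> 0"
  proof
    assume "c = 0"
    with st have "d = - r * m"
      by simp
    then have "r *\<^sub>R (1, 0, - m) = 1 *\<^sub>R (r, c, d)"
      using \<open>c = 0\<close> by simp
    then have "proportional (1, 0, - m) (r, c, d)"
      unfolding proportional_def by (intro exI[of _ r] exI[of _ 1]) simp
    with assms(3) show False ..
  qed
  have wall: "(u, v) \<in> potential_wall (1, 0, - m) (r, c, d)
      \<longleftrightarrow> v > 0 \<and> u\<^sup>2 + v\<^sup>2 + 2 * m = 2 * u * x" for u v
  proof -
    have "(u\<^sup>2 + v\<^sup>2) * c - 2 * u * (d + r * m) + 2 * (c * m)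
        = c * (u\<^sup>2 + v\<^sup>2 + 2 * m - 2 * u * x)"
      using c by (simp add: x_def field_simps)
    then show ?thesis
      using c by simp
  qed
  have eq: "s\<^sup>2 + t\<^sup>2 + 2 * m = 2 * s * x"
    using st wall[of s t] by simp
  have pos: "u\<^sup>2 + v\<^sup>2 + 2 * m > 0" for u v :: real
    using \<open>m > 0\<close> by (simp add: add_nonneg_pos)
  show x: "x < 0"
    using eq pos[of s t] st(1) by (simp add: zero_less_mult_iff)
  have "(x - s)\<^sup>2 + t\<^sup>2 = x\<^sup>2 - 2 * m"
    using eq by (simp add: power2_eq_square algebra_simps)
  moreover have "(x - s)\<^sup>2 + t\<^sup>2 > 0"
    using st(2) by (simp add: add_nonneg_pos)
  ultimately show rad: "x\<^sup>2 - 2 * m > 0"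
    by simp
  have "u < 0" if "u\<^sup>2 + v\<^sup>2 + 2 * m = 2 * u * x" for u v
    using that pos[of u v] x by (simp add: zero_less_mult_iff)
  then show "potential_wall (1, 0, - m) (r, c, d) \<inter> left_region
      = semicircle x (sqrt (x\<^sup>2 - 2 * m))"
    by (auto simp: wall mem_semicircle_iff[OF rad] left_region_def
        simp del: potential_wall.simps)
qed

text \<open>The distance between the centres is less than the difference of the radii. Squaring reduces
  this to \<open>2 (y - x) (y + \<rho>) < 0\<close>, where \<open>\<rho>\<close> is the radius of the disc of centre \<open>y\<close>; it holds
  because \<open>m > 0\<close> makes \<open>\<rho> < - y\<close>.\<close>

lemma disc_subset:
  fixes x y m :: real
  assumes "x < y" "y < 0" "m > 0" "y\<^sup>2 - m > 0"
  shows "cball (y, 0 :: real) (sqrt (y\<^sup>2 - m)) \<subseteq> ball (x, 0) (sqrt (x\<^sup>2 - m))"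
proof -
  define \<rho> where "\<rho> = sqrt (y\<^sup>2 - m)"
  have sq: "\<rho>\<^sup>2 = y\<^sup>2 - m"
    using assms(4) by (simp add: \<rho>_def)
  have "\<rho> < - y"
    unfolding \<rho>_def using assms by (intro real_less_lsqrt) auto
  then have "2 * ((y - x) * (y + \<rho>)) < 0"
    using assms(1) by (simp add: mult_pos_neg)
  moreover have "(\<rho> + (y - x))\<^sup>2 = x\<^sup>2 - m + 2 * ((y - x) * (y + \<rho>))"
    using sq by (simp add: power2_eq_square algebra_simps)
  ultimately have "\<rho> + (y - x) < sqrt (x\<^sup>2 - m)"
    by (intro real_less_rsqrt) simp
  moreover have "dist (x, 0 :: real) (y, 0 :: real) = y - x"
    using assms(1) by (simp add: dist_Pair_Pair dist_real_def)
  ultimately have lt: "\<rho> + dist (x, 0 :: real) (y, 0 :: real) < sqrt (x\<^sup>2 - m)"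
    by simp
  show ?thesis
  proof
    fix p assume "p \<in> cball (y, 0 :: real) (sqrt (y\<^sup>2 - m))"
    then have "dist (y, 0) p \<le> \<rho>"
      by (simp add: \<rho>_def)
    with lt show "p \<in> ball (x, 0) (sqrt (x\<^sup>2 - m))"
      using dist_triangle[of "(x, 0)" p "(y, 0)"] by simp
  qed
qed

lemma semicircles_disjoint:
  assumes "x \<noteq> y" "m > 0" "x\<^sup>2 - m > 0" "y\<^sup>2 - m > 0"
  shows "semicircle x (sqrt (x\<^sup>2 - m)) \<inter> semicircle y (sqrt (y\<^sup>2 - m)) = {}"
proof -
  have False if "s\<^sup>2 + t\<^sup>2 + m = 2 * s * x" "s\<^sup>2 + t\<^sup>2 + m = 2 * s * y" for s t :: real
  proof -
    have "s = 0"
      using that assms(1) by simp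
    with that(1) have "t\<^sup>2 + m = 0"
      by simp
    with \<open>m > 0\<close> show False
      by (metis add_nonneg_pos less_irrefl zero_le_power2)
  qed
  then show ?thesis
    using mem_semicircle_iff[OF assms(3)] mem_semicircle_iff[OF assms(4)] by fastforce
qed

lemma semicircles_nested:
  assumes "x \<noteq> y" "x < 0" "y < 0" "m > 0" "x\<^sup>2 - m > 0" "y\<^sup>2 - m > 0"
  shows "nested_semicircles (semicircle x (sqrt (x\<^sup>2 - m))) (semicircle y (sqrt (y\<^sup>2 - m)))"
proof -
  have "cball (x, 0 :: real) (sqrt (x\<^sup>2 - m)) \<subseteq> ball (y, 0) (sqrt (y\<^sup>2 - m)) \<or>
      cball (y, 0 :: real) (sqrt (y\<^sup>2 - m)) \<subseteq> ball (x, 0) (sqrt (x\<^sup>2 - m))"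
    using disc_subset[of x y m] disc_subset[of y x m] assms by argo
  then show ?thesis
    unfolding nested_semicircles_def using assms(5,6) real_sqrt_gt_zero by blast
qed

lemma bridgeland_wall_left_semicircle:
  assumes "m > 0" "W \<in> bridgeland_walls (1, 0, - m)" "W \<inter> left_region \<noteq> {}"
  obtains x where "x < 0" "x\<^sup>2 - 2 * m > 0" "W \<inter> left_region = semicircle x (sqrt (x\<^sup>2 - 2 * m))"
proof -
  obtain s t A where A: "destabilizing_object (1, 0, - m) s t A"
    and W: "W = potential_wall (1, 0, - m) (ch A)"
    using assms(2) by (auto simp: bridgeland_walls_def)
  obtain r c d where ch: "ch A = (r, c, d)"
    by (cases "ch A")
  have "\<not> proportional (1, 0, - m) (r, c, d)"
    using A unfolding destabilizing_object_def ch by blast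
  from potential_wall_left_semicircle[OF assms(1) this] that show ?thesis
    using assms(3) unfolding W ch by blast
qed

theorem mainTheorem8:
  fixes n :: nat
  assumes "n \<ge> 2"
  shows
    "(\<forall>W\<in>bridgeland_walls (1, 0, - real n). W \<inter> left_region \<noteq> {} \<longrightarrow>
        (\<exists>x \<rho>. \<rho> > 0 \<and> W \<inter> left_region = semicircle x \<rho>)) \<and>
     (\<forall>s t A r c d. destabilizing_object (1, 0, - real n) s t A \<and> ch A = (r, c, d) \<and>
          potential_wall (1, 0, - real n) (r, c, d) \<inter> left_region \<noteq> {} \<longrightarrow>
        (let x = (d + r * real n) / c in
          c \<noteq> 0 \<and> x\<^sup>2 - 2 * real n > 0 \<and>
          potential_wall (1, 0, - real n) (r, c, d) \<inter> left_region
            = semicircle x (sqrt (x\<^sup>2 - 2 * real n)))) \<and>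
     (\<forall>W\<in>bridgeland_walls (1, 0, - real n). \<forall>W'\<in>bridgeland_walls (1, 0, - real n).
        W \<inter> left_region \<noteq> {} \<and> W' \<inter> left_region \<noteq> {} \<and> W \<inter> left_region \<noteq> W' \<inter> left_region \<longrightarrow>
        (W \<inter> left_region) \<inter> (W' \<inter> left_region) = {} \<and>
        nested_semicircles (W \<inter> left_region) (W' \<inter> left_region))"
proof -
  define m where "m = real n"
  have m: "m > 0"
    using assms by (simp add: m_def)
  show ?thesis
    unfolding m_def[symmetric]
  proof (intro conjI ballI allI impI)
    fix W assume "W \<in> bridgeland_walls (1, 0, - m)" "W \<inter> left_region \<noteq> {}"
    from bridgeland_wall_left_semicircle[OF m this]
    show "\<exists>x \<rho>. \<rho> > 0 \<and> W \<inter> left_region = semicircle x \<rho>"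
      by (metis real_sqrt_gt_zero)
  next
    fix s t A r c d
    assume A: "destabilizing_object (1, 0, - m) s t A \<and> ch A = (r, c, d) \<and>
      potential_wall (1, 0, - m) (r, c, d) \<inter> left_region \<noteq> {}"
    then have "\<not> proportional (1, 0, - m) (r, c, d)"
      unfolding destabilizing_object_def by metis
    from potential_wall_left_semicircle[OF m this] A
    show "let x = (d + r * m) / c in c \<noteq> 0 \<and> x\<^sup>2 - 2 * m > 0 \<and>
        potential_wall (1, 0, - m) (r, c, d) \<inter> left_region
          = semicircle x (sqrt (x\<^sup>2 - 2 * m))"
      unfolding Let_def by blast
  next
    fix W W'
    assume W: "W \<in> bridgeland_walls (1, 0, - m)" "W' \<in> bridgeland_walls (1, 0, - m)"
      and *: "W \<inter> left_region \<noteq> {} \<and> W' \<inter> left_region \<noteq> {} \<and>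
        W \<inter> left_region \<noteq> W' \<inter> left_region"
    obtain x where x: "x < 0" "x\<^sup>2 - 2 * m > 0"
        "W \<inter> left_region = semicircle x (sqrt (x\<^sup>2 - 2 * m))"
      using bridgeland_wall_left_semicircle[OF m W(1)] * by blast
    obtain y where y: "y < 0" "y\<^sup>2 - 2 * m > 0"
        "W' \<inter> left_region = semicircle y (sqrt (y\<^sup>2 - 2 * m))"
      using bridgeland_wall_left_semicircle[OF m W(2)] * by blast
    have "x \<noteq> y"
      using * x(3) y(3) by auto
    then show "(W \<inter> left_region) \<inter> (W' \<inter> left_region) = {}"
      and "nested_semicircles (W \<inter> left_region) (W' \<inter> left_region)"
      unfolding x(3) y(3)
      using semicircles_disjoint[of x y "2 * m"] semicircles_nested[of x y "2 * m"] m x y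
      by simp_all
  qed
qed

end
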